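(* Let $K\ge 1$ and $r\ge 0$ be integers, and let $\bar\lambda_1 > \bar\lambda_2 > \cdots > \bar\lambda_K = 0$ be integers such that, for each $1\le i\le K-1$, $\bar\lambda_i - \bar\lambda_{i+1} = 2\eta_i + 1$ for some nonnegative integer $\eta_i$. Then $$r! \sum_{(\delta_1,\ldots,\delta_K)} \det\left(\frac{1}{\left(\delta_j + \frac12(\bar\lambda_i - \bar\lambda_j - i + j)\right)!}\right)_{1\le i,j\le K} \times \frac{\prod_{1\le i<j\le K}(\bar\lambda_i - \bar\lambda_j - 2\delta_i + 2\delta_j - i + j)}{\prod_{1\le i<j\le K}(\bar\lambda_i-\bar\lambda_j - i + j)} = K^r,$$ where the sum is over all tuples of nonnegative integers $\delta_1,\ldots,\delta_K$ with $\sum_{i=1}^K \delta_i = r$ and $$\delta_i \le \delta_{i+1} + \tfrac12(\bar\lambda_i - \bar\lambda_{i+1} - 1), \qquad 1\le i\le K-1.$$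
   Context: In the determinant, the convention is that $\frac{1}{m!} = 0$ when $m$ is a negative integer. The arguments of the factorials are integers because each difference $\bar\lambda_i-\bar\lambda_{i+1}$ is odd. Empty products are equal to $1$. *)

theory Defs
  imports "Jordan_Normal_Form.Determinant"
begin

definition inv_fact :: "int \<Rightarrow> rat" where
  "inv_fact m = (if m < 0 then 0 else 1 / fact (nat m))"

text \<open>Below, \<open>\<Lambda> 1, \<dots>, \<Lambda> K\<close> are the integers written as lambda-bar in the mathematical text; values of
  \<open>\<Lambda>\<close> outside \<open>{1..K}\<close> are irrelevant. Every halved integer is even whenever the consecutive
  differences of \<open>\<Lambda>\<close> are odd, so \<open>div 2\<close> is exact division.\<close>

text \<open>Extensional functions represent tuples indexed by \<open>{1..K}\<close>, each tuple exactly once.\<close>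

definition admissible :: "nat \<Rightarrow> (nat \<Rightarrow> int) \<Rightarrow> nat \<Rightarrow> (nat \<Rightarrow> nat) set" where
  "admissible K \<Lambda> r =
    {\<delta> \<in> {1..K} \<rightarrow>\<^sub>E UNIV.
       (\<Sum>i = 1..K. \<delta> i) = r \<and>
       (\<forall>i \<in> {1..<K}. int (\<delta> i) \<le> int (\<delta> (i + 1)) + (\<Lambda> i - \<Lambda> (i + 1) - 1) div 2)}"

text \<open>Library matrices are indexed from 0; the shift by one restores the indices \<open>1, \<dots>, K\<close>.\<close>

definition fact_matrix :: "nat \<Rightarrow> (nat \<Rightarrow> int) \<Rightarrow> (nat \<Rightarrow> nat) \<Rightarrow> rat mat" where
  "fact_matrix K \<Lambda> \<delta> =
    mat K K (\<lambda>(i', j'). let i = i' + 1; j = j' + 1 in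
      inv_fact (int (\<delta> j) + (\<Lambda> i - \<Lambda> j - int i + int j) div 2))"

end

theory Submission
  imports Defs
begin

text \<open>Put \<open>\<beta>\<^sub>i = (\<Lambda>\<^sub>i - i + K) / 2\<close> and \<open>y\<^sub>j = \<delta>\<^sub>j - \<beta>\<^sub>j\<close>. Admissibility of \<open>\<delta>\<close> says that \<open>y\<close> is strictly
  increasing, the determinant has entries \<open>1 / (y\<^sub>j + \<beta>\<^sub>i)!\<close>, and the ratio of products is
  \<open>V(y) / V(-\<beta>)\<close> with \<open>V\<close> the Vandermonde determinant. For strictly increasing \<open>y\<close> the determinant
  vanishes through a zero block unless every \<open>y\<^sub>j + \<beta>\<^sub>j\<close> is nonnegative, so the condition \<open>\<delta>\<^sub>j \<ge> 0\<close> can be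
  dropped. Expanding the determinant and using that \<open>V\<close> is alternating turns the sum over increasing
  \<open>y\<close> into the sum over all \<open>y\<close> of \<open>V(y) / \<Prod>\<^sub>j (y\<^sub>j + \<beta>\<^sub>j)!\<close>, that is, into the multinomial sum
  \<open>\<Sum>\<^sub>d V(d - \<beta>) / \<Prod>\<^sub>j d\<^sub>j!\<close> over all compositions \<open>d\<close> of \<open>r\<close>. Times \<open>r!\<close> this is \<open>K\<^sup>r V(-\<beta>)\<close>, because
  \<open>\<Sum>\<^sub>j V(x + e\<^sub>j) = K V(x)\<close>: shifting the variable acts on polynomials of degree below \<open>K\<close> by a
  unitriangular matrix, which has trace \<open>K\<close>.\<close>

section \<open>Vandermonde determinants under shifts of the variables\<close>

text \<open>Rows carry the powers and columns the variables, so a change of polynomial basis is a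
  left multiplication and a shift of one variable touches one column.\<close>

definition vandermonde :: "nat \<Rightarrow> (nat \<Rightarrow> 'a :: comm_ring_1) \<Rightarrow> 'a mat" where
  "vandermonde n x = mat n n (\<lambda>(i, j). x j ^ i)"

lemma vandermonde_carrier [simp]: "vandermonde n x \<in> carrier_mat n n"
  by (simp add: vandermonde_def)

lemma vandermonde_cong:
  assumes "\<And>j. j < n \<Longrightarrow> x j = y j"
  shows "vandermonde n x = vandermonde n y"
  using assms by (auto simp: vandermonde_def intro!: eq_matI)

text \<open>Change of basis from the monomials; the degree bound ensures that the first
  \<open>n\<close> monomials suffice. It is applied to the Newton basis and to the powers of
  \<open>X + h\<close>.\<close>

lemma mat_poly_eq_coeff_mat_times_vandermonde:
  assumes "\<And>i. i < n \<Longrightarrow> degree (p i) < n"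
  shows "mat n n (\<lambda>(i, j). poly (p i) (x j)) = mat n n (\<lambda>(i, k). coeff (p i) k) * vandermonde n x"
proof (rule eq_matI)
  fix i j assume ij: "i < dim_row (mat n n (\<lambda>(i, k). coeff (p i) k) * vandermonde n x)"
    "j < dim_col (mat n n (\<lambda>(i, k). coeff (p i) k) * vandermonde n x)"
  then have i: "i < n" and j: "j < n" by (auto simp: vandermonde_def)
  have "poly (p i) (x j) = (\<Sum>k\<le>degree (p i). coeff (p i) k * x j ^ k)"
    by (rule poly_altdef)
  also have "\<dots> = (\<Sum>k = 0..<n. coeff (p i) k * x j ^ k)"
    using assms[OF i] by (intro sum.mono_neutral_left) (auto simp: coeff_eq_0)
  finally show "mat n n (\<lambda>(i, j). poly (p i) (x j)) $$ (i, j)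
      = (mat n n (\<lambda>(i, k). coeff (p i) k) * vandermonde n x) $$ (i, j)"
    using i j by (simp add: scalar_prod_def vandermonde_def)
qed (auto simp: vandermonde_def)

text \<open>In the Newton basis \<open>p i\<close> the evaluation matrix is upper triangular, since
  \<open>p i\<close> vanishes at \<open>x j\<close> for \<open>j < i\<close>. The polynomials are
  monic of degree \<open>i\<close>, so the change of basis has determinant 1.\<close>

lemma det_vandermonde:
  fixes x :: "nat \<Rightarrow> 'a :: idom"
  shows "det (vandermonde n x) = (\<Prod>j<n. \<Prod>i<j. x j - x i)"
proof -
  define p where "p i = (\<Prod>k<i. [:- x k, 1:])" for i
  have deg: "degree (p i) = i" for i
    unfolding p_def by (subst degree_prod_sum_eq) auto
  have lead: "coeff (p i) i = 1" for i
    using lead_coeff_prod[of "\<lambda>k. [:- x k, 1:]" "{..<i}"] deg[of i] by (simp add: p_def)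
  let ?L = "mat n n (\<lambda>(i, k). coeff (p i) k)"
  let ?M = "mat n n (\<lambda>(i, j). poly (p i) (x j))"
  have "det ?L = 1"
    by (subst det_lower_triangular[of n])
      (auto simp: deg lead coeff_eq_0 prod_list_diag_prod)
  moreover have "det ?M = prod_list (diag_mat ?M)"
    by (rule det_upper_triangular[of _ n])
      (auto simp: upper_triangular_def p_def poly_prod)
  moreover have "prod_list (diag_mat ?M) = (\<Prod>j<n. \<Prod>i<j. x j - x i)"
    by (auto simp: prod_list_diag_prod p_def poly_prod atLeast0LessThan intro!: prod.cong)
  moreover have "?M = ?L * vandermonde n x"
    by (rule mat_poly_eq_coeff_mat_times_vandermonde) (simp add: deg)
  ultimately show ?thesis
    using det_mult[of ?L n "vandermonde n x"] by simp
qed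

text \<open>The derivative of \<open>det\<close> at \<open>M\<close> in direction \<open>A * M\<close>, written out column by column.\<close>

lemma sum_det_replace_col:
  fixes A M :: "'a :: comm_ring_1 mat"
  assumes A: "A \<in> carrier_mat n n" and M: "M \<in> carrier_mat n n"
  shows "(\<Sum>l<n. det (mat n n (\<lambda>(i, j). if j = l then (A * M) $$ (i, j) else M $$ (i, j))))
    = (\<Sum>i<n. A $$ (i, i)) * det M"
proof -
  let ?R = "\<lambda>l. mat n n (\<lambda>(i, j). if j = l then (A * M) $$ (i, j) else M $$ (i, j))"
  \<comment> \<open>Expand along column \<open>l\<close>: its cofactors do not involve that column,
    hence agree with those of \<open>M\<close>.\<close>
  have exp: "det (?R l) = (\<Sum>i<n. (A * M) $$ (i, l) * cofactor M i l)" if l: "l < n" for l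
  proof -
    have "cofactor (?R l) i l = cofactor M i l" if i: "i < n" for i
    proof -
      have "mat_delete (?R l) i l = mat_delete M i l"
        using M i l by (auto simp: mat_delete_def intro!: eq_matI)
      then show ?thesis by (simp add: cofactor_def)
    qed
    then show ?thesis
      using l by (subst laplace_expansion_column[of _ n l]) (auto intro!: sum.cong)
  qed
  \<comment> \<open>\<open>M\<close> times its adjugate is \<open>det M\<close> times the identity;
    this removes all but the diagonal entries of \<open>A\<close> and leaves the trace.\<close>
  have adj: "(\<Sum>l<n. M $$ (k, l) * cofactor M i l) = (if k = i then det M else 0)"
    if "k < n" "i < n" for i k
  proof -
    have "(M * adj_mat M) $$ (k, i) = (\<Sum>l<n. M $$ (k, l) * cofactor M i l)"
      using M that by (auto simp: adj_mat_def scalar_prod_def atLeast0LessThan intro!: sum.cong)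
    then show ?thesis using adj_mat(2)[OF M] that by auto
  qed
  have "(\<Sum>l<n. det (?R l))
      = (\<Sum>l<n. \<Sum>i<n. \<Sum>k<n. A $$ (i, k) * (M $$ (k, l) * cofactor M i l))"
    using A M
    by (auto simp: exp scalar_prod_def atLeast0LessThan sum_distrib_right mult.assoc intro!: sum.cong)
  also have "\<dots> = (\<Sum>i<n. \<Sum>l<n. \<Sum>k<n. A $$ (i, k) * (M $$ (k, l) * cofactor M i l))"
    by (rule sum.swap)
  also have "\<dots> = (\<Sum>i<n. \<Sum>k<n. \<Sum>l<n. A $$ (i, k) * (M $$ (k, l) * cofactor M i l))"
    by (intro sum.cong refl sum.swap)
  also have "\<dots> = (\<Sum>i<n. \<Sum>k<n. A $$ (i, k) * (if k = i then det M else 0))"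
    by (intro sum.cong refl) (simp add: sum_distrib_left[symmetric] adj)
  also have "\<dots> = (\<Sum>i<n. A $$ (i, i) * det M)"
    by (intro sum.cong refl) (simp add: if_distrib cong: if_cong)
  finally show ?thesis by (simp add: sum_distrib_right)
qed

text \<open>Row \<open>i\<close> of \<open>?A\<close> holds the coefficients of
  \<open>(X + h) ^ i\<close>. Shifting variable \<open>l\<close> replaces column \<open>l\<close> of
  \<open>?M\<close> by that of \<open>?A * ?M\<close>, so the sum is the trace of \<open>?A\<close>
  times \<open>det ?M\<close>, and the diagonal of \<open>?A\<close> consists of ones.\<close>

lemma sum_det_vandermonde_shift:
  fixes x :: "nat \<Rightarrow> 'a :: idom"
  shows "(\<Sum>l<n. det (vandermonde n (x(l := x l + h)))) = of_nat n * det (vandermonde n x)"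
proof -
  define p where "p i = [:h, 1:] ^ i" for i
  have deg: "degree (p i) = i" for i by (simp add: p_def degree_linear_power)
  have lead: "coeff (p i) i = 1" for i
    using lead_coeff_power[of "[:h, 1:]" i] deg[of i] by (simp add: p_def)
  let ?A = "mat n n (\<lambda>(i, k). coeff (p i) k)" and ?M = "vandermonde n x"
  have AM: "?A * ?M = mat n n (\<lambda>(i, j). (x j + h) ^ i)"
    by (subst mat_poly_eq_coeff_mat_times_vandermonde[symmetric])
      (auto simp: deg, auto simp: p_def poly_power add.commute)
  have "vandermonde n (x(l := x l + h))
      = mat n n (\<lambda>(i, j). if j = l then (?A * ?M) $$ (i, j) else ?M $$ (i, j))" for l
    unfolding AM by (auto simp: vandermonde_def intro!: eq_matI)
  then have "(\<Sum>l<n. det (vandermonde n (x(l := x l + h)))) = (\<Sum>i<n. ?A $$ (i, i)) * det ?M"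
    using sum_det_replace_col[of ?A n ?M] by simp
  then show ?thesis by (simp add: lead)
qed

lemma det_vandermonde_permute:
  assumes p: "p permutes {0..<n}"
  shows "det (vandermonde n (x \<circ> p)) = signof p * det (vandermonde n x)"
proof -
  \<comment> \<open>Transposing turns the permutation of the variables into one of rows.\<close>
  let ?T = "transpose_mat (vandermonde n x)"
  have T: "?T \<in> carrier_mat n n" by simp
  have "det (vandermonde n (x \<circ> p)) = det (transpose_mat (vandermonde n (x \<circ> p)))"
    by (rule det_transpose[symmetric, OF vandermonde_carrier])
  also have "transpose_mat (vandermonde n (x \<circ> p)) = mat n n (\<lambda>(i, j). ?T $$ (p i, j))"
  proof (rule eq_matI)
    fix i j assume "i < dim_row (mat n n (\<lambda>(i, j). ?T $$ (p i, j)))"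
      and "j < dim_col (mat n n (\<lambda>(i, j). ?T $$ (p i, j)))"
    then show "transpose_mat (vandermonde n (x \<circ> p)) $$ (i, j)
        = mat n n (\<lambda>(i, j). ?T $$ (p i, j)) $$ (i, j)"
      using permutes_in_image[OF p, of i] by (simp add: vandermonde_def)
  qed (simp_all add: vandermonde_def)
  also have "det \<dots> = signof p * det ?T"
    by (rule det_permute_rows[OF T p])
  also have "det ?T = det (vandermonde n x)"
    by (rule det_transpose[OF vandermonde_carrier])
  finally show ?thesis .
qed

lemma det_vandermonde_not_inj:
  fixes x :: "nat \<Rightarrow> 'a :: idom"
  assumes "\<not> inj_on x {0..<n}"
  shows "det (vandermonde n x) = 0"
proof -
  obtain i j where "i < n" "j < n" "i \<noteq> j" "x i = x j"
    using assms by (auto simp: inj_on_def)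
  then obtain i j where "i < j" "j < n" "x i = x j"
    by (metis linorder_neqE_nat)
  then have "\<exists>j<n. \<exists>i<j. x j - x i = 0" by (metis right_minus_eq)
  then show ?thesis by (auto simp: det_vandermonde)
qed

section \<open>Multinomial averages of shifts\<close>

text \<open>Weak compositions, with zero parts allowed; extensionality makes each tuple occur
  once.\<close>

definition compositions :: "nat \<Rightarrow> nat \<Rightarrow> (nat \<Rightarrow> nat) set" where
  "compositions n r = {d \<in> {0..<n} \<rightarrow>\<^sub>E UNIV. (\<Sum>i<n. d i) = r}"

lemma finite_compositions: "finite (compositions n r)"
proof (rule finite_subset)
  show "compositions n r \<subseteq> {0..<n} \<rightarrow>\<^sub>E {..r}"
  proof
    fix d assume d: "d \<in> compositions n r"
    have "d i \<le> r" if "i < n" for i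
      using member_le_sum[of i "{..<n}" d] that d by (auto simp: compositions_def)
    then show "d \<in> {0..<n} \<rightarrow>\<^sub>E {..r}"
      using d by (auto simp: compositions_def PiE_iff)
  qed
qed (auto intro: finite_PiE)

text \<open>The multinomial coefficient counts the walks of \<open>r\<close> unit steps from the
  origin to \<open>d\<close>. By hypothesis, summing \<open>F\<close> over the \<open>n\<close>
  possible next steps multiplies it by \<open>n\<close>, so each induction step contributes one
  factor \<open>n\<close>.\<close>

lemma sum_compositions_harmonic:
  fixes F :: "(nat \<Rightarrow> nat) \<Rightarrow> 'a :: field_char_0"
  assumes harmonic: "\<And>d. d \<in> {0..<n} \<rightarrow>\<^sub>E UNIV \<Longrightarrow>
      (\<Sum>j<n. F (d(j := Suc (d j)))) = of_nat n * F d"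
  shows "fact r * (\<Sum>d\<in>compositions n r. F d / (\<Prod>i<n. fact (d i)))
    = of_nat n ^ r * F (restrict (\<lambda>_. 0) {0..<n})"
proof (induction r)
  case 0
  have "compositions n 0 = {restrict (\<lambda>_. 0) {0..<n}}"
    by (auto simp: compositions_def PiE_iff extensional_def restrict_def)
  then show ?case by simp
next
  case (Suc r)
  let ?c = "\<lambda>d :: nat \<Rightarrow> nat. (\<Prod>i<n. fact (d i)) :: 'a"
  have c_upd: "?c (d(j := Suc (d j))) = of_nat (Suc (d j)) * ?c d" if "j < n" for d j
  proof -
    have "?c (d(j := Suc (d j))) = fact (Suc (d j)) * (\<Prod>i\<in>{..<n} - {j}. fact (d i))"
      using that by (subst prod.remove[of _ j]) (auto intro!: prod.cong)
    moreover have "?c d = fact (d j) * (\<Prod>i\<in>{..<n} - {j}. fact (d i))"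
      using that by (subst prod.remove[of _ j]) auto
    ultimately show ?thesis by (simp add: algebra_simps)
  qed
  have sum_upd: "(\<Sum>i<n. (d(j := v)) i) = v + (\<Sum>i\<in>{..<n} - {j}. d i)"
    and sum_rem: "(\<Sum>i<n. d i) = d j + (\<Sum>i\<in>{..<n} - {j}. d i)"
    if "j < n" for d :: "nat \<Rightarrow> nat" and j v
    using that by (subst sum.remove[of _ j]; auto intro!: sum.cong)+
  \<comment> \<open>The factor \<open>d j\<close> kills the terms with \<open>d j = 0\<close> and
    otherwise lowers the factorial of \<open>d j\<close> by one, so lowering part \<open>j\<close>
    matches the remaining terms with compositions of \<open>r\<close>.\<close>
  have raise: "(\<Sum>d\<in>compositions n (Suc r). of_nat (d j) * (F d / ?c d))
      = (\<Sum>d\<in>compositions n r. F (d(j := Suc (d j))) / ?c d)" if j: "j < n" for j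
  proof -
    have "(\<Sum>d\<in>compositions n (Suc r). of_nat (d j) * (F d / ?c d))
        = (\<Sum>d\<in>{d \<in> compositions n (Suc r). d j > 0}. of_nat (d j) * (F d / ?c d))"
      by (rule sum.mono_neutral_right) (auto simp: finite_compositions)
    also have "\<dots> = (\<Sum>d\<in>compositions n r. F (d(j := Suc (d j))) / ?c d)"
    proof (rule sum.reindex_bij_witness[of _ "\<lambda>d. d(j := Suc (d j))" "\<lambda>d. d(j := d j - 1)"])
      fix d assume d: "d \<in> {d \<in> compositions n (Suc r). d j > 0}"
      show "d(j := d j - 1) \<in> compositions n r"
        using d j sum_rem[OF j, of d] sum_upd[OF j, of d "d j - 1"]
        by (auto simp: compositions_def PiE_iff extensional_def)
      show eq: "(d(j := d j - 1))(j := Suc ((d(j := d j - 1)) j)) = d"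
        using d by auto
      define e where "e = d(j := d j - 1)"
      have de: "d = e(j := Suc (e j))" using eq by (simp add: e_def)
      have "of_nat (d j) * (F d / ?c d) = F d / ?c e"
        using c_upd[OF j, of e] by (subst (3) de, subst (1) de) (simp del: of_nat_Suc)
      then show "F ((d(j := d j - 1))(j := Suc ((d(j := d j - 1)) j))) / ?c (d(j := d j - 1))
          = of_nat (d j) * (F d / ?c d)"
        unfolding eq by (simp add: e_def)
    next
      fix d assume d: "d \<in> compositions n r"
      show "d(j := Suc (d j)) \<in> {d \<in> compositions n (Suc r). d j > 0}"
        using d j sum_rem[OF j, of d] sum_upd[OF j, of d "Suc (d j)"]
        by (auto simp: compositions_def PiE_iff extensional_def)
    qed auto
    finally show ?thesis .
  qed
  \<comment> \<open>Write \<open>Suc r\<close> as the sum of the parts of \<open>d\<close>, so that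
    \<open>raise\<close> applies to each index separately.\<close>
  have "of_nat (Suc r) * (\<Sum>d\<in>compositions n (Suc r). F d / ?c d)
      = (\<Sum>d\<in>compositions n (Suc r). (\<Sum>j<n. of_nat (d j)) * (F d / ?c d))"
    unfolding sum_distrib_left
    by (intro sum.cong refl) (auto simp: compositions_def of_nat_sum[symmetric] simp del: of_nat_Suc)
  also have "\<dots> = (\<Sum>j<n. \<Sum>d\<in>compositions n (Suc r). of_nat (d j) * (F d / ?c d))"
    unfolding sum_distrib_right by (rule sum.swap)
  also have "\<dots> = (\<Sum>j<n. \<Sum>d\<in>compositions n r. F (d(j := Suc (d j))) / ?c d)"
    by (intro sum.cong refl raise) simp
  also have "\<dots> = (\<Sum>d\<in>compositions n r. (\<Sum>j<n. F (d(j := Suc (d j)))) / ?c d)"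
    unfolding sum_divide_distrib by (rule sum.swap)
  also have "\<dots> = of_nat n * (\<Sum>d\<in>compositions n r. F d / ?c d)"
    unfolding sum_distrib_left
    by (intro sum.cong refl) (subst harmonic, auto simp: compositions_def)
  finally have step: "of_nat (Suc r) * (\<Sum>d\<in>compositions n (Suc r). F d / ?c d)
      = of_nat n * (\<Sum>d\<in>compositions n r. F d / ?c d)" .
  have "fact (Suc r) * (\<Sum>d\<in>compositions n (Suc r). F d / ?c d)
      = fact r * (of_nat (Suc r) * (\<Sum>d\<in>compositions n (Suc r). F d / ?c d))"
    by (simp add: algebra_simps)
  also have "\<dots> = of_nat n * (fact r * (\<Sum>d\<in>compositions n r. F d / ?c d))"
    unfolding step by (simp add: algebra_simps)
  finally show ?case unfolding Suc.IH power_Suc by (simp only: mult.assoc)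
qed

section \<open>Sorting injective tuples\<close>

lemma strict_mono_on_atLeastLessThan_iff_Suc:
  fixes y :: "nat \<Rightarrow> 'a :: order"
  shows "strict_mono_on {0..<n} y \<longleftrightarrow> (\<forall>i. Suc i < n \<longrightarrow> y i < y (Suc i))"
proof
  assume "\<forall>i. Suc i < n \<longrightarrow> y i < y (Suc i)"
  then have "sorted_wrt (<) (map y [0..<n])"
    by (subst sorted_wrt_iff_nth_Suc_transp) (auto intro: transpI)
  then show "strict_mono_on {0..<n} y"
    by (auto simp: sorted_wrt_iff_nth_less strict_mono_on_def)
qed (auto simp: strict_mono_on_def)

text \<open>A sorted list without repetitions is determined by its set of values; this gives
  uniqueness of the sorted rearrangement.\<close>

lemma strict_mono_on_eqI_image:
  fixes y z :: "nat \<Rightarrow> 'a :: linorder"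
  assumes "strict_mono_on {0..<n} y" "strict_mono_on {0..<n} z" "y ` {0..<n} = z ` {0..<n}"
    and "i < n"
  shows "y i = z i"
proof -
  have "sorted (map w [0..<n]) \<and> distinct (map w [0..<n])" if "strict_mono_on {0..<n} w"
    for w :: "nat \<Rightarrow> 'a"
    using that strict_mono_on_imp_inj_on[OF that]
    by (auto simp: sorted_iff_nth_mono_less distinct_map strict_mono_on_def less_imp_le)
  then have "map y [0..<n] = map z [0..<n]"
    using assms by (intro sorted_distinct_set_unique) auto
  then show ?thesis using \<open>i < n\<close> by simp
qed

text \<open>Take the permutation that sorts the list of values; injectivity makes the weak order
  strict.\<close>

lemma ex_strict_mono_on_permutes:
  fixes y :: "nat \<Rightarrow> 'a :: linorder"
  assumes "inj_on y {0..<n}"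
  obtains p where "p permutes {0..<n}" "strict_mono_on {0..<n} (y \<circ> p)"
proof -
  obtain p where p: "p permutes {..<n}" "permute_list p (map y [0..<n]) = sort (map y [0..<n])"
    using mset_eq_permutation[of "sort (map y [0..<n])" "map y [0..<n]"] by auto
  have perm: "p permutes {0..<n}" using p by (simp add: atLeast0LessThan)
  have nth: "sort (map y [0..<n]) ! i = y (p i)" if "i < n" for i
    using p that permutes_in_image[OF perm, of i]
    by (simp add: permute_list_nth flip: p(2))
  have "sorted (sort (map y [0..<n]))" by simp
  then have le: "y (p i) \<le> y (p j)" if "i < j" "j < n" for i j
    using that nth[of i] nth[of j] sorted_nth_mono[of "sort (map y [0..<n])" i j] by simp
  have ne: "y (p i) \<noteq> y (p j)" if "i < j" "j < n" for i j
  proof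
    assume "y (p i) = y (p j)"
    then have "p i = p j"
      using assms that permutes_in_image[OF perm, of i] permutes_in_image[OF perm, of j]
      by (auto dest: inj_onD)
    then show False using permutes_inj[OF perm] that by (auto dest: injD)
  qed
  have "strict_mono_on {0..<n} (y \<circ> p)"
    using le ne by (auto simp: strict_mono_on_def order_less_le)
  with perm show thesis by (rule that)
qed

text \<open>An injective tuple factors uniquely as a strictly increasing tuple after a permutation.
  Extensionality reduces equality of tuples to the indices below \<open>n\<close>.\<close>

lemma sum_inj_eq_sum_strict_mono_permutes:
  fixes F :: "(nat \<Rightarrow> 'a :: linorder) \<Rightarrow> 'b :: comm_monoid_add"
  assumes ext: "\<And>y. y \<in> Y \<Longrightarrow> y \<in> extensional {0..<n}"
    and closed: "\<And>y p. y \<in> Y \<Longrightarrow> p permutes {0..<n} \<Longrightarrow> y \<circ> p \<in> Y"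
  shows "(\<Sum>y\<in>{y \<in> Y. inj_on y {0..<n}}. F y)
    = (\<Sum>z\<in>{z \<in> Y. strict_mono_on {0..<n} z}. \<Sum>p | p permutes {0..<n}. F (z \<circ> p))"
proof -
  let ?S = "{z \<in> Y. strict_mono_on {0..<n} z}" and ?P = "{p. p permutes {0..<n}}"
  have "bij_betw (\<lambda>(z, p). z \<circ> p) (?S \<times> ?P) {y \<in> Y. inj_on y {0..<n}}"
    unfolding bij_betw_def
  proof
    show "inj_on (\<lambda>(z, p). z \<circ> p) (?S \<times> ?P)"
    proof (rule inj_onI, clarify)
      fix z p w q
      assume zw: "z \<in> Y" "strict_mono_on {0..<n} z" "w \<in> Y" "strict_mono_on {0..<n} w"
        and p: "p permutes {0..<n}" and q: "q permutes {0..<n}" and eq: "z \<circ> p = w \<circ> q"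
      \<comment> \<open>A permutation does not change the image, and the image determines the
        increasing tuple.\<close>
      have "z ` {0..<n} = (z \<circ> p) ` {0..<n}" "w ` {0..<n} = (w \<circ> q) ` {0..<n}"
        by (simp_all only: image_comp[symmetric] permutes_image[OF p] permutes_image[OF q])
      then have "z i = w i" if "i < n" for i
        using that zw eq by (intro strict_mono_on_eqI_image[of n]) auto
      then have zw_eq: "z = w"
        using ext[OF zw(1)] ext[OF zw(3)] by (intro extensionalityI) auto
      have "p i = q i" for i
      proof (cases "i < n")
        case True
        then show ?thesis
          using fun_cong[OF eq, of i] zw_eq strict_mono_on_imp_inj_on[OF zw(2)]
            permutes_in_image[OF p, of i] permutes_in_image[OF q, of i]
          by (auto dest: inj_onD)
      next
        case False
        then show ?thesis using p q by (simp add: permutes_not_in)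
      qed
      with zw_eq show "z = w \<and> p = q" by auto
    qed
    show "(\<lambda>(z, p). z \<circ> p) ` (?S \<times> ?P) = {y \<in> Y. inj_on y {0..<n}}"
    proof (intro equalityI subsetI)
      fix y assume "y \<in> (\<lambda>(z, p). z \<circ> p) ` (?S \<times> ?P)"
      then obtain z p where zp: "y = z \<circ> p" "z \<in> Y" "strict_mono_on {0..<n} z" "p permutes {0..<n}"
        by auto
      then have "inj_on y {0..<n}"
        using strict_mono_on_imp_inj_on[OF zp(3)]
        by (auto intro!: comp_inj_on permutes_inj_on simp: permutes_image)
      with zp closed show "y \<in> {y \<in> Y. inj_on y {0..<n}}" by auto
    next
      fix y assume y: "y \<in> {y \<in> Y. inj_on y {0..<n}}"
      then obtain p where p: "p permutes {0..<n}" "strict_mono_on {0..<n} (y \<circ> p)"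
        using ex_strict_mono_on_permutes by blast
      have "y = (y \<circ> p) \<circ> inv_into UNIV p"
        using permutes_inv_o(1)[OF p(1)] by (simp add: comp_assoc)
      moreover have "(y \<circ> p, inv_into UNIV p) \<in> ?S \<times> ?P"
        using y p closed permutes_inv by auto
      ultimately show "y \<in> (\<lambda>(z, p). z \<circ> p) ` (?S \<times> ?P)"
        by (metis (no_types, lifting) case_prod_conv image_eqI)
    qed
  qed
  then have "(\<Sum>y\<in>{y \<in> Y. inj_on y {0..<n}}. F y) = (\<Sum>(z, p)\<in>?S \<times> ?P. F (z \<circ> p))"
    by (subst sum.reindex_bij_betw[symmetric]) (auto simp: case_prod_unfold)
  then show ?thesis by (simp add: sum.cartesian_product)
qed

section \<open>The determinantal sum\<close>

text \<open>Pigeonhole: a permutation avoiding the block would inject the \<open>n - m\<close> rows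
  from \<open>m\<close> on into the \<open>n - m - 1\<close> columns beyond \<open>m\<close>. Hence
  every Leibniz term has a zero factor.\<close>

lemma det_zero_block:
  fixes A :: "'a :: comm_ring_1 mat"
  assumes A: "A \<in> carrier_mat n n" and m: "m < n"
    and zero: "\<And>k l. m \<le> k \<Longrightarrow> k < n \<Longrightarrow> l \<le> m \<Longrightarrow> A $$ (k, l) = 0"
  shows "det A = 0"
proof -
  have "(\<Prod>i = 0..<n. A $$ (i, p i)) = 0" if p: "p permutes {0..<n}" for p
  proof -
    have "\<exists>k\<in>{m..<n}. p k \<le> m"
    proof (rule ccontr)
      assume "\<not> ?thesis"
      then have "p ` {m..<n} \<subseteq> {Suc m..<n}"
        using permutes_in_image[OF p] by force
      then have "card (p ` {m..<n}) \<le> card {Suc m..<n}" by (intro card_mono) auto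
      then show False using m by (simp add: card_image permutes_inj_on[OF p])
    qed
    then obtain k where "m \<le> k" "k < n" "p k \<le> m" by auto
    then have "k \<in> {0..<n}" "A $$ (k, p k) = 0" using zero by auto
    then show ?thesis by (intro prod_zero) auto
  qed
  then show ?thesis by (simp add: det_def'[OF A])
qed

text \<open>Permuting the variables of the Vandermonde determinant supplies exactly the sign of the
  Leibniz expansion.\<close>

lemma sum_strict_mono_permutes_expansion:
  fixes z :: "nat \<Rightarrow> int"
  shows "(\<Sum>p | p permutes {0..<n}. (\<Prod>i<n. inv_fact ((z \<circ> p) i + \<beta> i)) *
        det (vandermonde n (\<lambda>j. of_int ((z \<circ> p) j))))
    = det (mat n n (\<lambda>(i, j). inv_fact (z j + \<beta> i))) * det (vandermonde n (\<lambda>j. of_int (z j)))"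
proof -
  let ?A = "mat n n (\<lambda>(i, j). inv_fact (z j + \<beta> i))"
  have "(\<Prod>i<n. inv_fact ((z \<circ> p) i + \<beta> i)) * det (vandermonde n (\<lambda>j. of_int ((z \<circ> p) j)))
      = signof p * (\<Prod>i = 0..<n. ?A $$ (i, p i)) * det (vandermonde n (\<lambda>j. of_int (z j)))"
    if p: "p permutes {0..<n}" for p
  proof -
    have "(\<Prod>i = 0..<n. ?A $$ (i, p i)) = (\<Prod>i<n. inv_fact ((z \<circ> p) i + \<beta> i))"
      using permutes_in_image[OF p] by (auto simp: atLeast0LessThan intro!: prod.cong)
    then show ?thesis
      using det_vandermonde_permute[OF p, of "\<lambda>j. of_int (z j) :: rat"] by (simp add: comp_def)
  qed
  then show ?thesis
    by (simp add: det_def'[of ?A n] sum_distrib_right)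
qed

text \<open>For \<open>l \<le> m \<le> k\<close> monotonicity gives
  \<open>z l + \<beta> k \<le> z m + \<beta> m < 0\<close>, and \<open>inv_fact\<close> is zero
  there: this is the block of \<open>det_zero_block\<close>.\<close>

lemma det_inv_fact_eq_0:
  assumes z: "strict_mono_on {0..<n} z" and \<beta>: "\<And>i j. i < j \<Longrightarrow> j < n \<Longrightarrow> \<beta> j < \<beta> i"
    and m: "m < n" "z m + \<beta> m < 0"
  shows "det (mat n n (\<lambda>(i, j). inv_fact (z j + \<beta> i))) = 0"
proof (rule det_zero_block[OF _ m(1)])
  fix k l assume kl: "m \<le> k" "k < n" "l \<le> m"
  have "z l \<le> z m" using strict_mono_onD[OF z, of l m] kl m(1) by (cases "l = m") auto
  moreover have "\<beta> k \<le> \<beta> m" using \<beta>[of m k] kl by (cases "k = m") auto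
  ultimately have "z l + \<beta> k < 0" using m by linarith
  then show "mat n n (\<lambda>(i, j). inv_fact (z j + \<beta> i)) $$ (k, l) = 0"
    using kl m by (simp add: inv_fact_def)
qed simp

text \<open>The identity with its denominator cleared, for any strictly decreasing integers
  \<open>\<beta>\<close>. Permuting \<open>y = d - \<beta>\<close> can make some
  \<open>y i + \<beta> i\<close> negative, so the proof passes to a permutation-invariant set of
  tuples \<open>y\<close> and back.\<close>

lemma sum_strict_mono_det_inv_fact:
  fixes \<beta> :: "nat \<Rightarrow> int"
  assumes \<beta>: "\<And>i j. i < j \<Longrightarrow> j < n \<Longrightarrow> \<beta> j < \<beta> i"
  shows "fact r * (\<Sum>d\<in>{d \<in> compositions n r. strict_mono_on {0..<n} (\<lambda>j. int (d j) - \<beta> j)}.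
        det (mat n n (\<lambda>(i, j). inv_fact (int (d j) - \<beta> j + \<beta> i))) *
        det (vandermonde n (\<lambda>j. of_int (int (d j) - \<beta> j))))
    = of_nat n ^ r * det (vandermonde n (\<lambda>j. of_int (- \<beta> j)))"
proof -
  define V where "V y = det (vandermonde n (\<lambda>j. of_int (y j) :: rat))" for y :: "nat \<Rightarrow> int"
  define G where "G y = det (mat n n (\<lambda>(i, j). inv_fact (y j + \<beta> i)))" for y
  define W where "W y = (\<Prod>i<n. inv_fact (y i + \<beta> i))" for y
  \<comment> \<open>Large enough that \<open>int (d i) - \<beta> i\<close> lies in
    \<open>{- M..M}\<close> whenever \<open>d i \<le> r\<close>.\<close>
  define M where "M = int r + (\<Sum>i<n. \<bar>\<beta> i\<bar>)"
  \<comment> \<open>A finite, permutation-invariant box containing the support of \<open>W\<close>.\<close>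
  define Y where "Y = {y \<in> {0..<n} \<rightarrow>\<^sub>E {- M..M}. (\<Sum>i<n. y i + \<beta> i) = int r}"
  define \<tau> where "\<tau> d = restrict (\<lambda>j. int (d j) - \<beta> j) {0..<n}" for d :: "nat \<Rightarrow> nat"
  have V_cong: "V y = V z" if "\<And>j. j < n \<Longrightarrow> y j = z j" for y z
    unfolding V_def using that by (intro arg_cong[of _ _ det] vandermonde_cong) simp
  have finY: "finite Y"
    unfolding Y_def by (rule finite_subset[of _ "{0..<n} \<rightarrow>\<^sub>E {- M..M}"]) (auto intro: finite_PiE)
  have Y_perm: "y \<circ> p \<in> Y" if y: "y \<in> Y" and p: "p permutes {0..<n}" for y p
  proof -
    have "(\<Sum>i\<in>{0..<n}. (y \<circ> p) i) = (\<Sum>i\<in>{0..<n}. y i)"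
      using sum.permute[OF p, of y] by simp
    then have "(\<Sum>i<n. (y \<circ> p) i + \<beta> i) = (\<Sum>i<n. y i + \<beta> i)"
      by (simp add: sum.distrib atLeast0LessThan)
    moreover have "y \<circ> p \<in> {0..<n} \<rightarrow>\<^sub>E {- M..M}"
      using y permutes_in_image[OF p] permutes_not_in[OF p]
      by (auto simp: Y_def PiE_iff extensional_def)
    ultimately show ?thesis using y by (simp add: Y_def)
  qed
  \<comment> \<open>The map \<open>\<tau>\<close> identifies compositions with the \<open>y\<close>
    in \<open>Y\<close> having all \<open>y i + \<beta> i\<close> nonnegative. It is used once where
    a factor of \<open>W\<close> vanishes off this set, and once where the determinant
    \<open>G\<close> does.\<close>
  have transfer: "(\<Sum>d\<in>compositions n r. H (\<tau> d)) = (\<Sum>y\<in>Y. H y)"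
    if H: "\<And>y i. y \<in> Y \<Longrightarrow> i < n \<Longrightarrow> y i + \<beta> i < 0 \<Longrightarrow> H y = 0" for H :: "(nat \<Rightarrow> int) \<Rightarrow> rat"
  proof -
    have "(\<Sum>d\<in>compositions n r. H (\<tau> d)) = (\<Sum>y\<in>{y \<in> Y. \<forall>i<n. 0 \<le> y i + \<beta> i}. H y)"
    proof (rule sum.reindex_bij_witness[of _
          "\<lambda>y. restrict (\<lambda>j. nat (y j + \<beta> j)) {0..<n}" \<tau>])
      fix d assume d: "d \<in> compositions n r"
      then show "restrict (\<lambda>j. nat (\<tau> d j + \<beta> j)) {0..<n} = d"
        by (auto simp: \<tau>_def compositions_def PiE_iff intro!: extensionalityI[of _ "{0..<n}"])
      have sum_d: "(\<Sum>i<n. d i) = r" using d by (simp add: compositions_def)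
      have bd: "\<bar>int (d i) - \<beta> i\<bar> \<le> M" if i: "i < n" for i
      proof -
        have "d i \<le> r" using member_le_sum[of i "{..<n}" d] i sum_d by auto
        moreover have "\<bar>\<beta> i\<bar> \<le> (\<Sum>i<n. \<bar>\<beta> i\<bar>)"
          using member_le_sum[of i "{..<n}" "\<lambda>i. \<bar>\<beta> i\<bar>"] i by auto
        ultimately show ?thesis unfolding M_def by linarith
      qed
      have "(\<Sum>i<n. \<tau> d i + \<beta> i) = int r"
        using sum_d by (simp add: \<tau>_def flip: of_nat_sum)
      moreover have "\<tau> d \<in> {0..<n} \<rightarrow>\<^sub>E {- M..M}"
        using bd by (fastforce simp: \<tau>_def PiE_iff abs_le_iff)
      ultimately show "\<tau> d \<in> {y \<in> Y. \<forall>i<n. 0 \<le> y i + \<beta> i}"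
        by (auto simp: Y_def \<tau>_def)
    next
      fix y assume y: "y \<in> {y \<in> Y. \<forall>i<n. 0 \<le> y i + \<beta> i}"
      then show "\<tau> (restrict (\<lambda>j. nat (y j + \<beta> j)) {0..<n}) = y"
        by (auto simp: \<tau>_def Y_def PiE_iff intro!: extensionalityI[of _ "{0..<n}"])
      have "int (\<Sum>i<n. nat (y i + \<beta> i)) = int r"
        using y by (simp add: Y_def)
      then have "(\<Sum>i<n. nat (y i + \<beta> i)) = r" by (simp only: of_nat_eq_iff)
      then show "restrict (\<lambda>j. nat (y j + \<beta> j)) {0..<n} \<in> compositions n r"
        by (simp add: compositions_def PiE_iff)
    qed simp
    also have "\<dots> = (\<Sum>y\<in>Y. H y)"
      by (rule sum.mono_neutral_left[OF finY]) (use H in \<open>force simp: not_le\<close>)+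
    finally show ?thesis .
  qed
  have W_tau: "W (\<tau> d) = 1 / (\<Prod>i<n. fact (d i))" for d
    by (simp add: W_def \<tau>_def inv_fact_def prod_dividef)
  have multinomial: "fact r * (\<Sum>d\<in>compositions n r. V (\<tau> d) / (\<Prod>i<n. fact (d i)))
      = of_nat n ^ r * V (\<tau> (restrict (\<lambda>_. 0) {0..<n}))"
  proof (rule sum_compositions_harmonic)
    fix d :: "nat \<Rightarrow> nat"
    let ?x = "\<lambda>j. of_int (\<tau> d j) :: rat"
    \<comment> \<open>Raising \<open>d j\<close> by one shifts variable \<open>j\<close> by 1, so
      \<open>V\<close> composed with \<open>\<tau>\<close> is harmonic.\<close>
    have "V (\<tau> (d(j := Suc (d j)))) = det (vandermonde n (?x(j := ?x j + 1)))" if "j < n" for j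
      unfolding V_def using that
      by (intro arg_cong[of _ _ det] vandermonde_cong) (simp add: \<tau>_def)
    then show "(\<Sum>j<n. V (\<tau> (d(j := Suc (d j))))) = of_nat n * V (\<tau> d)"
      using sum_det_vandermonde_shift[of n ?x 1] by (simp add: V_def)
  qed
  have "(\<Sum>d\<in>compositions n r. V (\<tau> d) / (\<Prod>i<n. fact (d i)))
      = (\<Sum>d\<in>compositions n r. W (\<tau> d) * V (\<tau> d))"
    by (simp add: W_tau)
  also have "\<dots> = (\<Sum>y\<in>Y. W y * V y)"
  proof (rule transfer)
    fix y i assume "i < n" "y i + \<beta> i < 0"
    then have "W y = 0" unfolding W_def by (intro prod_zero) (auto simp: inv_fact_def)
    then show "W y * V y = 0" by simp
  qed
  also have "\<dots> = (\<Sum>y\<in>{y \<in> Y. inj_on y {0..<n}}. W y * V y)"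
  proof (rule sum.mono_neutral_right[OF finY])
    have "V y = 0" if "\<not> inj_on y {0..<n}" for y
      unfolding V_def using that by (intro det_vandermonde_not_inj) (auto simp: inj_on_def)
    then show "\<forall>y\<in>Y - {y \<in> Y. inj_on y {0..<n}}. W y * V y = 0" by auto
  qed auto
  also have "\<dots> = (\<Sum>z\<in>{z \<in> Y. strict_mono_on {0..<n} z}.
      \<Sum>p | p permutes {0..<n}. W (z \<circ> p) * V (z \<circ> p))"
    by (rule sum_inj_eq_sum_strict_mono_permutes)
      (use Y_perm in \<open>auto simp: Y_def PiE_iff\<close>)
  also have "\<dots> = (\<Sum>z\<in>{z \<in> Y. strict_mono_on {0..<n} z}. G z * V z)"
    unfolding W_def V_def G_def by (simp only: sum_strict_mono_permutes_expansion)
  \<comment> \<open>Monotonicity moves into the summand because \<open>transfer\<close> concerns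
    sums over all of \<open>Y\<close>.\<close>
  also have "\<dots> = (\<Sum>z\<in>Y. if strict_mono_on {0..<n} z then G z * V z else 0)"
    by (rule sum.inter_filter[OF finY])
  also have "\<dots> = (\<Sum>d\<in>compositions n r.
      if strict_mono_on {0..<n} (\<tau> d) then G (\<tau> d) * V (\<tau> d) else 0)"
    by (rule transfer[symmetric]) (auto simp: G_def intro: det_inv_fact_eq_0 \<beta>)
  also have "\<dots> = (\<Sum>d\<in>{d \<in> compositions n r. strict_mono_on {0..<n} (\<tau> d)}. G (\<tau> d) * V (\<tau> d))"
    by (rule sum.inter_filter[symmetric, OF finite_compositions])
  also have "{d \<in> compositions n r. strict_mono_on {0..<n} (\<tau> d)}
      = {d \<in> compositions n r. strict_mono_on {0..<n} (\<lambda>j. int (d j) - \<beta> j)}"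
    by (auto simp: \<tau>_def strict_mono_on_def)
  also have "(\<Sum>d\<in>\<dots>. G (\<tau> d) * V (\<tau> d))
      = (\<Sum>d\<in>{d \<in> compositions n r. strict_mono_on {0..<n} (\<lambda>j. int (d j) - \<beta> j)}.
        det (mat n n (\<lambda>(i, j). inv_fact (int (d j) - \<beta> j + \<beta> i))) *
        det (vandermonde n (\<lambda>j. of_int (int (d j) - \<beta> j))))"
  proof (rule sum.cong[OF refl])
    fix d :: "nat \<Rightarrow> nat"
    have "V (\<tau> d) = V (\<lambda>j. int (d j) - \<beta> j)" by (rule V_cong) (simp add: \<tau>_def)
    moreover have "mat n n (\<lambda>(i, j). inv_fact (\<tau> d j + \<beta> i))
        = mat n n (\<lambda>(i, j). inv_fact (int (d j) - \<beta> j + \<beta> i))"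
      by (auto simp: \<tau>_def intro!: eq_matI)
    ultimately show "G (\<tau> d) * V (\<tau> d) = det (mat n n (\<lambda>(i, j). inv_fact (int (d j) - \<beta> j + \<beta> i))) *
        det (vandermonde n (\<lambda>j. of_int (int (d j) - \<beta> j)))"
      by (simp add: G_def V_def)
  qed
  finally have sum_eq: "(\<Sum>d\<in>compositions n r. V (\<tau> d) / (\<Prod>i<n. fact (d i))) = \<dots>" .
  have "V (\<tau> (restrict (\<lambda>_. 0) {0..<n})) = det (vandermonde n (\<lambda>j. of_int (- \<beta> j)))"
    unfolding V_def by (intro arg_cong[of _ _ det] vandermonde_cong) (simp add: \<tau>_def)
  then show ?thesis using multinomial unfolding sum_eq by simp
qed

section \<open>Translation of the original data into integers \<open>\<beta>\<close> indexed from
  0\<close>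

lemma prod_pairs_eq:
  "(\<Prod>(i, j)\<in>{(i, j). 1 \<le> i \<and> i < j \<and> j \<le> K}. f i j) = (\<Prod>j<K. \<Prod>i<j. f (Suc i) (Suc j))"
proof -
  have "(\<Prod>j<K. \<Prod>i<j. f (Suc i) (Suc j))
      = (\<Prod>(j, i)\<in>(SIGMA j:{..<K}. {..<j}). f (Suc i) (Suc j))"
    by (rule prod.Sigma) auto
  also have "\<dots> = (\<Prod>(i, j)\<in>{(i, j). 1 \<le> i \<and> i < j \<and> j \<le> K}. f i j)"
    by (rule prod.reindex_bij_witness[of _ "\<lambda>(i, j). (j - 1, i - 1)" "\<lambda>(j, i). (Suc i, Suc j)"]) auto
  finally show ?thesis by simp
qed

theorem mainTheorem3:
  fixes K r :: nat and \<Lambda> :: "nat \<Rightarrow> int"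
  assumes "K \<ge> 1"
    and "\<And>i. 1 \<le> i \<Longrightarrow> i < K \<Longrightarrow> \<Lambda> i > \<Lambda> (i + 1)"
    and "\<Lambda> K = 0"
    and "\<And>i. 1 \<le> i \<Longrightarrow> i < K \<Longrightarrow> \<exists>\<eta>::nat. \<Lambda> i - \<Lambda> (i + 1) = 2 * int \<eta> + 1"
  shows "fact r * (\<Sum>\<delta> \<in> admissible K \<Lambda> r.
           det (fact_matrix K \<Lambda> \<delta>) *
           ((\<Prod>(i, j) \<in> {(i, j). 1 \<le> i \<and> i < j \<and> j \<le> K}.
               of_int (\<Lambda> i - \<Lambda> j - 2 * int (\<delta> i) + 2 * int (\<delta> j) - int i + int j)) /
            (\<Prod>(i, j) \<in> {(i, j). 1 \<le> i \<and> i < j \<and> j \<le> K}.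
               of_int (\<Lambda> i - \<Lambda> j - int i + int j))))
         = (of_nat K ^ r :: rat)"
proof -
  \<comment> \<open>Adding \<open>K\<close> makes the numerator 0 at the last index; each step down
    adds \<open>2 * (\<eta> + 1)\<close>, so the halves are integers. The \<open>K\<close> cancels
    in all differences.\<close>
  define \<beta> where "\<beta> j = (\<Lambda> (Suc j) - int (Suc j) + int K) div 2" for j
  have even: "even (\<Lambda> i - int i + int K)" if "1 \<le> i" "i \<le> K" for i
    using that(2,1)
  proof (induction i rule: inc_induct)
    case base
    then show ?case using assms(3) by simp
  next
    case (step i)
    obtain \<eta> :: nat where "\<Lambda> i - \<Lambda> (i + 1) = 2 * int \<eta> + 1" using assms(4) step by auto
    then have "\<Lambda> i - int i + int K = (\<Lambda> (Suc i) - int (Suc i) + int K) + 2 * (int \<eta> + 1)"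
      by simp
    then show ?case using step by (simp only: even_add) simp
  qed
  have two_\<beta>: "2 * \<beta> j = \<Lambda> (Suc j) - int (Suc j) + int K" if "j < K" for j
    unfolding \<beta>_def using even[of "Suc j"] that by (intro dvd_mult_div_cancel) auto
  have \<beta>_Suc: "(\<Lambda> (Suc j) - \<Lambda> (Suc (Suc j)) - 1) div 2 = \<beta> j - \<beta> (Suc j) - 1"
    and \<beta>_less: "\<beta> (Suc j) < \<beta> j" if "Suc j < K" for j
  proof -
    have "\<Lambda> (Suc j) - \<Lambda> (Suc (Suc j)) - 1 = 2 * (\<beta> j - \<beta> (Suc j) - 1)"
      using two_\<beta>[of j] two_\<beta>[of "Suc j"] that by simp
    then show "(\<Lambda> (Suc j) - \<Lambda> (Suc (Suc j)) - 1) div 2 = \<beta> j - \<beta> (Suc j) - 1" by simp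
    show "\<beta> (Suc j) < \<beta> j"
      using two_\<beta>[of j] two_\<beta>[of "Suc j"] assms(2)[of "Suc j"] assms(4)[of "Suc j"] that by auto
  qed
  then have "strict_mono_on {0..<K} (\<lambda>j. - \<beta> j)"
    by (simp add: strict_mono_on_atLeastLessThan_iff_Suc)
  then have \<beta>_dec: "\<beta> j < \<beta> i" if "i < j" "j < K" for i j
    using that by (auto simp: strict_mono_on_def)
  let ?D = "{d \<in> compositions K r. strict_mono_on {0..<K} (\<lambda>j. int (d j) - \<beta> j)}"
  \<comment> \<open>With \<open>y = \<delta> - \<beta>\<close>, each factor of the numerator is
    \<open>2 * (y j - y i)\<close>; \<open>?C\<close> collects the twos, which also occur in the
    denominator, the case \<open>\<delta> = 0\<close>.\<close>
  let ?C = "(\<Prod>j<K. \<Prod>i<j. 2) :: rat"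
  let ?V0 = "det (vandermonde K (\<lambda>j. of_int (- \<beta> j))) :: rat"
  have prod_eq: "(\<Prod>(i, j) \<in> {(i, j). 1 \<le> i \<and> i < j \<and> j \<le> K}.
      of_int (\<Lambda> i - \<Lambda> j - 2 * int (\<delta> i) + 2 * int (\<delta> j) - int i + int j))
      = ?C * det (vandermonde K (\<lambda>j. of_int (int (\<delta> (Suc j)) - \<beta> j)))" for \<delta>
  proof -
    have "(\<Prod>j<K. \<Prod>i<j. of_int (\<Lambda> (Suc i) - \<Lambda> (Suc j) - 2 * int (\<delta> (Suc i))
          + 2 * int (\<delta> (Suc j)) - int (Suc i) + int (Suc j)) :: rat)
        = (\<Prod>j<K. \<Prod>i<j. 2 * (of_int (int (\<delta> (Suc j)) - \<beta> j) - of_int (int (\<delta> (Suc i)) - \<beta> i)))"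
    proof (intro prod.cong refl)
      fix j i assume "j \<in> {..<K}" "i \<in> {..<j}"
      then have "\<Lambda> (Suc i) - \<Lambda> (Suc j) - 2 * int (\<delta> (Suc i)) + 2 * int (\<delta> (Suc j)) - int (Suc i)
          + int (Suc j) = 2 * ((int (\<delta> (Suc j)) - \<beta> j) - (int (\<delta> (Suc i)) - \<beta> i))"
        using two_\<beta>[of i] two_\<beta>[of j] by auto
      then show "of_int (\<Lambda> (Suc i) - \<Lambda> (Suc j) - 2 * int (\<delta> (Suc i)) + 2 * int (\<delta> (Suc j))
          - int (Suc i) + int (Suc j)) = (2 * (of_int (int (\<delta> (Suc j)) - \<beta> j)
            - of_int (int (\<delta> (Suc i)) - \<beta> i)) :: rat)"
        by (simp only: of_int_mult of_int_diff of_int_numeral)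
    qed
    then show ?thesis
      by (subst prod_pairs_eq) (simp only: det_vandermonde prod.distrib)
  qed
  have prod_0: "(\<Prod>(i, j) \<in> {(i, j). 1 \<le> i \<and> i < j \<and> j \<le> K}.
      of_int (\<Lambda> i - \<Lambda> j - int i + int j)) = ?C * ?V0"
    using prod_eq[of "\<lambda>_. 0"] by simp
  have cancel: "?C * a / (?C * b) = a / b" for a b
    by (rule mult_divide_mult_cancel_left) simp
  have V0_nz: "?V0 \<noteq> 0"
    using \<beta>_dec by (fastforce simp: det_vandermonde)
  have mat_eq: "fact_matrix K \<Lambda> \<delta> = mat K K (\<lambda>(i, j). inv_fact (int (\<delta> (Suc j)) - \<beta> j + \<beta> i))" for \<delta>
  proof (rule eq_matI)
    fix i j assume "i < dim_row (mat K K (\<lambda>(i, j). inv_fact (int (\<delta> (Suc j)) - \<beta> j + \<beta> i)))"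
      and "j < dim_col (mat K K (\<lambda>(i, j). inv_fact (int (\<delta> (Suc j)) - \<beta> j + \<beta> i)))"
    then have ij: "i < K" "j < K" by auto
    have "\<Lambda> (i + 1) - \<Lambda> (j + 1) - int (i + 1) + int (j + 1) = 2 * (\<beta> i - \<beta> j)"
      using two_\<beta>[of i] two_\<beta>[of j] ij by simp
    then have "int (\<delta> (j + 1)) + (\<Lambda> (i + 1) - \<Lambda> (j + 1) - int (i + 1) + int (j + 1)) div 2
        = int (\<delta> (Suc j)) - \<beta> j + \<beta> i"
      by (simp only:) simp
    then show "fact_matrix K \<Lambda> \<delta> $$ (i, j)
        = mat K K (\<lambda>(i, j). inv_fact (int (\<delta> (Suc j)) - \<beta> j + \<beta> i)) $$ (i, j)"
      using ij by (simp only: fact_matrix_def Let_def index_mat case_prod_conv)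
  qed (auto simp: fact_matrix_def)
  \<comment> \<open>Shift the indices from \<open>{1..K}\<close> to \<open>{0..<K}\<close>,
    restricting on both sides to keep the tuples extensional.\<close>
  have "(\<Sum>\<delta>\<in>admissible K \<Lambda> r. det (fact_matrix K \<Lambda> \<delta>) *
      (?C * det (vandermonde K (\<lambda>j. of_int (int (\<delta> (Suc j)) - \<beta> j))) / (?C * ?V0)))
      = (\<Sum>d\<in>?D. det (mat K K (\<lambda>(i, j). inv_fact (int (d j) - \<beta> j + \<beta> i))) *
          det (vandermonde K (\<lambda>j. of_int (int (d j) - \<beta> j))) / ?V0)"
  proof (rule sum.reindex_bij_witness[of _ "\<lambda>d. restrict (\<lambda>i. d (i - 1)) {1..K}"
        "\<lambda>\<delta>. restrict (\<lambda>j. \<delta> (Suc j)) {0..<K}"])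
    have sum_Suc: "(\<Sum>i = 1..K. \<delta> i) = (\<Sum>j<K. \<delta> (Suc j))" for \<delta> :: "nat \<Rightarrow> nat"
      by (rule sum.reindex_bij_witness[of _ Suc "\<lambda>i. i - 1"]) auto
    have ball_conv: "(\<forall>i\<in>{1..<K}. P i) \<longleftrightarrow> (\<forall>j. Suc j < K \<longrightarrow> P (Suc j))" for P
    proof (intro iffI ballI allI impI)
      fix i assume "\<forall>j. Suc j < K \<longrightarrow> P (Suc j)" "i \<in> {1..<K}"
      then show "P i" by (cases i) auto
    qed auto
    \<comment> \<open>By \<open>\<beta>_Suc\<close> the admissibility bound ends in
      \<open>- 1\<close>, which over the integers turns the weak inequality into a strict one
      between neighbours.\<close>
    have strict_iff: "strict_mono_on {0..<K} (\<lambda>j. int (\<delta> (Suc j)) - \<beta> j) \<longleftrightarrow>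
        (\<forall>i\<in>{1..<K}. int (\<delta> i) \<le> int (\<delta> (i + 1)) + (\<Lambda> i - \<Lambda> (i + 1) - 1) div 2)"
      (is "_ \<longleftrightarrow> ?R") for \<delta> :: "nat \<Rightarrow> nat"
    proof -
      have "?R \<longleftrightarrow> (\<forall>j. Suc j < K \<longrightarrow>
          int (\<delta> (Suc j)) \<le> int (\<delta> (Suc j + 1)) + (\<Lambda> (Suc j) - \<Lambda> (Suc j + 1) - 1) div 2)"
        by (rule ball_conv)
      also have "\<dots> \<longleftrightarrow> (\<forall>j. Suc j < K \<longrightarrow>
          int (\<delta> (Suc j)) - \<beta> j < int (\<delta> (Suc (Suc j))) - \<beta> (Suc j))"
        using \<beta>_Suc by (intro all_cong) (simp, linarith)
      finally show ?thesis by (simp add: strict_mono_on_atLeastLessThan_iff_Suc)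
    qed
    {
      fix \<delta> assume \<delta>: "\<delta> \<in> admissible K \<Lambda> r"
      then show "restrict (\<lambda>i. restrict (\<lambda>j. \<delta> (Suc j)) {0..<K} (i - 1)) {1..K} = \<delta>"
        by (intro extensionalityI[of _ "{1..K}"]) (auto simp: admissible_def PiE_iff)
      have "strict_mono_on {0..<K} (\<lambda>j. int (\<delta> (Suc j)) - \<beta> j)"
        using \<delta> strict_iff by (simp add: admissible_def)
      then show "restrict (\<lambda>j. \<delta> (Suc j)) {0..<K} \<in> ?D"
        using \<delta> sum_Suc[of \<delta>]
        by (auto simp: admissible_def compositions_def PiE_iff strict_mono_on_def)
      have "mat K K (\<lambda>(i, j). inv_fact (int (restrict (\<lambda>j. \<delta> (Suc j)) {0..<K} j) - \<beta> j + \<beta> i))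
          = fact_matrix K \<Lambda> \<delta>"
        unfolding mat_eq by (auto intro!: eq_matI)
      moreover have "vandermonde K (\<lambda>j. of_int (int (restrict (\<lambda>j. \<delta> (Suc j)) {0..<K} j) - \<beta> j) :: rat)
          = vandermonde K (\<lambda>j. of_int (int (\<delta> (Suc j)) - \<beta> j))"
        by (rule vandermonde_cong) simp
      ultimately show "det (mat K K (\<lambda>(i, j).
            inv_fact (int (restrict (\<lambda>j. \<delta> (Suc j)) {0..<K} j) - \<beta> j + \<beta> i))) *
          det (vandermonde K (\<lambda>j. of_int (int (restrict (\<lambda>j. \<delta> (Suc j)) {0..<K} j) - \<beta> j))) / ?V0
          = det (fact_matrix K \<Lambda> \<delta>) *
            (?C * det (vandermonde K (\<lambda>j. of_int (int (\<delta> (Suc j)) - \<beta> j))) / (?C * ?V0))"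
        by (simp only: cancel times_divide_eq_right)
    next
      fix d assume d: "d \<in> ?D"
      then show "restrict (\<lambda>j. restrict (\<lambda>i. d (i - 1)) {1..K} (Suc j)) {0..<K} = d"
        by (intro extensionalityI[of _ "{0..<K}"]) (auto simp: compositions_def PiE_iff)
      let ?\<delta> = "restrict (\<lambda>i. d (i - 1)) {1..K}"
      have "strict_mono_on {0..<K} (\<lambda>j. int (?\<delta> (Suc j)) - \<beta> j)"
        using d by (auto simp: strict_mono_on_def)
      then have "\<forall>i\<in>{1..<K}. int (?\<delta> i) \<le> int (?\<delta> (i + 1)) + (\<Lambda> i - \<Lambda> (i + 1) - 1) div 2"
        by (simp only: strict_iff)
      moreover have "(\<Sum>i = 1..K. ?\<delta> i) = r"
        unfolding sum_Suc using d by (simp add: compositions_def)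
      ultimately show "?\<delta> \<in> admissible K \<Lambda> r"
        unfolding admissible_def by (intro CollectI conjI restrict_PiE) auto
    }
  qed
  moreover have "fact r * (\<Sum>d\<in>?D. det (mat K K (\<lambda>(i, j). inv_fact (int (d j) - \<beta> j + \<beta> i))) *
      det (vandermonde K (\<lambda>j. of_int (int (d j) - \<beta> j)))) = of_nat K ^ r * ?V0"
    by (rule sum_strict_mono_det_inv_fact) (rule \<beta>_dec)
  ultimately have "fact r * (\<Sum>\<delta>\<in>admissible K \<Lambda> r. det (fact_matrix K \<Lambda> \<delta>) *
      (?C * det (vandermonde K (\<lambda>j. of_int (int (\<delta> (Suc j)) - \<beta> j))) / (?C * ?V0)))
      = of_nat K ^ r * ?V0 / ?V0"
    by (simp only: sum_divide_distrib[symmetric] times_divide_eq_right)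
  then show ?thesis
    unfolding prod_eq prod_0 using V0_nz by simp
qed

end
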